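(* Let $n,k\ge 1$ and let $H_1,\dots,H_k\subseteq\mathbb{R}^n$ be Lorenz hulls. For $j=1,\dots,k$ let $\boldsymbol{\mu}^j=(\mu^j_1,\dots,\mu^j_n)$ be an $n$-dimensional finite signed vector measure with $H_j=\mathsf{LH}(\boldsymbol{\mu}^j)$. Put $\boldsymbol{\mu}^\times:=(\mu_1^\times,\dots,\mu_n^\times)$ where $\mu_i^\times:=\mu_i^1\times\dots\times\mu_i^k$ for $i=1,\dots,n$. Then $\mathsf{LH}(\boldsymbol{\mu}^\times)$ depends only on $H_1,\dots,H_k$ and not on the choice of $\boldsymbol{\mu}^1,\dots,\boldsymbol{\mu}^k$; that is, if $\boldsymbol{\nu}^1,\dots,\boldsymbol{\nu}^k$ are further $n$-dimensional finite signed vector measures (possibly on other measurable spaces) with $\mathsf{LH}(\boldsymbol{\nu}^j)=H_j$ for $j=1,\dots,k$, then $\mathsf{LH}(\boldsymbol{\nu}^\times)=\mathsf{LH}(\boldsymbol{\mu}^\times)$, where $\boldsymbol{\nu}^\times$ is formed from $\boldsymbol{\nu}^1,\dots,\boldsymbol{\nu}^k$ in the same way.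
   Context: An $n$-dimensional finite signed vector measure on a measurable space $(S,\mathcal{F})$ is an $n$-tuple $\boldsymbol{\mu}=(\mu_1,\dots,\mu_n)$ of finite signed measures on $(S,\mathcal{F})$, viewed as a map $\boldsymbol{\mu}:\mathcal{F}\to\mathbb{R}^n$, $\boldsymbol{\mu}(A)=(\mu_1(A),\dots,\mu_n(A))$. Its Lorenz hull $\mathsf{LH}(\boldsymbol{\mu})$ is the convex hull in $\mathbb{R}^n$ of its range $\{\boldsymbol{\mu}(A):A\in\mathcal{F}\}$. A Lorenz hull in $\mathbb{R}^n$ is a set of the form $\mathsf{LH}(\boldsymbol{\mu})$ for some $n$-dimensional finite signed vector measure on some measurable space. The measures $\boldsymbol{\mu}^1,\dots,\boldsymbol{\mu}^k$ may live on different measurable spaces $(S_j,\mathcal{F}_j)$. The product $\alpha^1\times\dots\times\alpha^k$ of finite signed measures $\alpha^j$ on $(S_j,\mathcal{F}_j)$ is the unique finite signed measure on the product measurable space $\prod_j (S_j,\mathcal{F}_j)$ satisfying $(\alpha^1\times\dots\times\alpha^k)(A_1\times\dots\times A_k)=\alpha^1(A_1)\cdots\alpha^k(A_k)$ for all $A_j\in\mathcal{F}_j$. *)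

theory Defs
  imports "HOL-Analysis.Analysis"
begin

text \<open>
  A value of type \<^typ>\<open>'a measure\<close> serves here only as a measurable space: nothing below
  depends on its \<^const>\<open>emeasure\<close>. Signed measures are real-valued set functions, of which only
  the values on measurable sets matter.
\<close>

definition finite_signed_measure :: "'a measure \<Rightarrow> ('a set \<Rightarrow> real) \<Rightarrow> bool" where
  "finite_signed_measure M \<alpha> \<longleftrightarrow>
     \<alpha> {} = 0 \<and>
     (\<forall>A :: nat \<Rightarrow> 'a set. range A \<subseteq> sets M \<longrightarrow> disjoint_family A \<longrightarrow>
        (\<lambda>m. \<alpha> (A m)) sums \<alpha> (\<Union>m. A m))"

definition finite_signed_vector_measure ::
    "'a measure \<Rightarrow> ('a set \<Rightarrow> real ^ 'n) \<Rightarrow> bool" where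
  "finite_signed_vector_measure M \<mu> \<longleftrightarrow> (\<forall>i. finite_signed_measure M (\<lambda>A. \<mu> A $ i))"

definition lorenz_hull :: "'a measure \<Rightarrow> ('a set \<Rightarrow> real ^ 'n) \<Rightarrow> (real ^ 'n) set" where
  "lorenz_hull M \<mu> = convex hull (\<mu> ` sets M)"

text \<open>
  The product of signed measures is determined by its values on measurable boxes, but only as a
  function on the product sigma-algebra. As for \<^const>\<open>emeasure\<close>, the value on non-measurable
  sets is fixed to be \<open>0\<close>; without this the definite description would not denote.
\<close>

definition product_signed_measure ::
    "'j set \<Rightarrow> ('j \<Rightarrow> 'a measure) \<Rightarrow> ('j \<Rightarrow> 'a set \<Rightarrow> real) \<Rightarrow> ('j \<Rightarrow> 'a) set \<Rightarrow> real" where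
  "product_signed_measure J M \<alpha> =
     (THE \<beta>. finite_signed_measure (PiM J M) \<beta> \<and>
        (\<forall>A. (\<forall>j\<in>J. A j \<in> sets (M j)) \<longrightarrow> \<beta> (PiE J A) = (\<Prod>j\<in>J. \<alpha> j (A j))) \<and>
        (\<forall>E. E \<notin> sets (PiM J M) \<longrightarrow> \<beta> E = 0))"

definition product_vector_measure ::
    "'j set \<Rightarrow> ('j \<Rightarrow> 'a measure) \<Rightarrow> ('j \<Rightarrow> 'a set \<Rightarrow> real ^ 'n) \<Rightarrow> ('j \<Rightarrow> 'a) set \<Rightarrow> real ^ 'n" where
  "product_vector_measure J M \<mu> =
     (\<lambda>E. \<chi> i. product_signed_measure J M (\<lambda>j A. \<mu> j A $ i) E)"

end

theory Submission
  imports Defs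
begin

text \<open>
  The support function of a Lorenz hull is an integral, and for a product measure this integral can
  be evaluated one factor at a time, where each factor enters only through its own support function.

  Write a vector measure as \<open>\<mu> = g L\<close> with a finite positive measure \<open>L\<close> and a density
  \<open>g = (g\<^sub>1, \<dots>, g\<^sub>n)\<close>. For a direction \<open>u\<close>, the value \<open>u \<bullet> \<mu> A\<close> is largest when \<open>A\<close> is the set
  where \<open>u \<bullet> g \<ge> 0\<close>, so the support function of \<open>LH(\<mu>)\<close> is \<open>u \<mapsto> \<integral> (u \<bullet> g)\<^sup>+ \<partial>L\<close>
  (\<open>support_integral\<close>). A product of vector measures has the density whose \<open>i\<close>-th component is
  \<open>\<Prod>j. g\<^sup>j\<^sub>i (x\<^sub>j)\<close> with respect to the product of the \<open>L\<^sup>j\<close>. If all coordinates but \<open>x\<^sub>j\<close> are fixed,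
  the integral over \<open>x\<^sub>j\<close> is the support function of \<open>H\<^sub>j\<close> at the vector with components
  \<open>u\<^sub>i \<Prod>l\<noteq>j. g\<^sup>l\<^sub>i (x\<^sub>l)\<close>. Hence, by Fubini, factor \<open>j\<close> may be exchanged for any other vector measure
  with hull \<open>H\<^sub>j\<close> without changing the integral (\<open>product_support_integral_cong\<close>): the two product
  measures have hulls with the same support function.

  Support functions determine only the closure of a convex set, so it remains to see that a Lorenz
  hull is closed (\<open>closed_lorenz_hull\<close>). By the theorem of Krein, Milman and Minkowski this follows
  once every extreme point \<open>x\<close> of the convex hull of the closure of the range is itself a value of
  \<open>\<mu>\<close>. Such an \<open>x\<close> is a limit of values \<open>\<mu> A\<^sub>n\<close>. Moving a set \<open>D \<subseteq> A\<^sub>m - A\<^sub>n\<close> from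
  \<open>A\<^sub>m\<close> to \<open>A\<^sub>n\<close> does not change \<open>\<mu> A\<^sub>m + \<mu> A\<^sub>n\<close>, which is close to \<open>2x\<close>; by extremality both
  new values are again close to \<open>x\<close>, so \<open>\<mu> D\<close> is small, uniformly in \<open>D\<close>. Thus the \<open>A\<^sub>n\<close> form a
  Cauchy sequence for the variation of \<open>\<mu>\<close>, and they converge to a set with value \<open>x\<close>.
\<close>

section \<open>Jordan decomposition of finite signed measures\<close>

lemma finite_signed_measureD:
  assumes "finite_signed_measure M \<alpha>" "range A \<subseteq> sets M" "disjoint_family A"
  shows "(\<lambda>m::nat. \<alpha> (A m)) sums \<alpha> (\<Union>m. A m)"
  using assms unfolding finite_signed_measure_def by blast

lemma finite_signed_measure_empty: "finite_signed_measure M \<alpha> \<Longrightarrow> \<alpha> {} = 0"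
  by (simp add: finite_signed_measure_def)

lemma finite_signed_measure_Un:
  assumes \<alpha>: "finite_signed_measure M \<alpha>" and AB: "A \<in> sets M" "B \<in> sets M" "A \<inter> B = {}"
  shows "\<alpha> (A \<union> B) = \<alpha> A + \<alpha> B"
proof -
  have "range (binaryset A B) \<subseteq> sets M"
    using AB by (simp add: range_binaryset_eq)
  moreover have "disjoint_family (binaryset A B)"
    using AB(3) by (auto simp: disjoint_family_on_def binaryset_def)
  ultimately have "(\<lambda>n. \<alpha> (binaryset A B n)) sums \<alpha> (\<Union>n. binaryset A B n)"
    by (rule finite_signed_measureD[OF \<alpha>])
  moreover have "(\<lambda>n. \<alpha> (binaryset A B n)) sums (\<alpha> A + \<alpha> B)"
    by (rule binaryset_sums[of \<alpha>, OF finite_signed_measure_empty[OF \<alpha>]])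
  ultimately show ?thesis
    using sums_unique2 by (fastforce simp: UN_binaryset_eq)
qed

lemma finite_signed_measure_Diff:
  assumes "finite_signed_measure M \<alpha>" "A \<in> sets M" "B \<in> sets M" "B \<subseteq> A"
  shows "\<alpha> (A - B) = \<alpha> A - \<alpha> B"
proof -
  have "B \<union> (A - B) = A" using assms(4) by auto
  then show ?thesis
    using finite_signed_measure_Un[of M \<alpha> B "A - B"] assms by auto
qed

lemma finite_signed_measure_add:
  assumes "finite_signed_measure M \<alpha>" "finite_signed_measure M \<beta>"
  shows "finite_signed_measure M (\<lambda>A. \<alpha> A + \<beta> A)"
  unfolding finite_signed_measure_def
  by (intro conjI allI impI sums_add finite_signed_measureD[OF assms(1)] finite_signed_measureD[OF assms(2)])
    (simp_all add: finite_signed_measure_empty[OF assms(1)] finite_signed_measure_empty[OF assms(2)])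

lemma finite_signed_measure_minus:
  assumes "finite_signed_measure M \<alpha>"
  shows "finite_signed_measure M (\<lambda>A. - \<alpha> A)"
  unfolding finite_signed_measure_def
  by (intro conjI allI impI sums_minus finite_signed_measureD[OF assms])
    (simp_all add: finite_signed_measure_empty[OF assms])

lemma finite_signed_measure_sum:
  assumes "\<And>i. i \<in> I \<Longrightarrow> finite_signed_measure M (\<alpha> i)"
  shows "finite_signed_measure M (\<lambda>A. \<Sum>i\<in>I. \<alpha> i A)"
  unfolding finite_signed_measure_def
  by (intro conjI allI impI sums_sum finite_signed_measureD[OF assms])
    (simp_all add: finite_signed_measure_empty[OF assms])

text \<open>
  If \<open>\<alpha>\<close> were unbounded, a set \<open>E\<close> on which it is unbounded could be split again and again:
  a subset \<open>B\<close> with \<open>\<bar>\<alpha> B\<bar> > 1 + \<bar>\<alpha> E\<bar>\<close> has \<open>\<bar>\<alpha> B\<bar> \<ge> 1\<close> and \<open>\<bar>\<alpha> (E - B)\<bar> \<ge> 1\<close>, and \<open>\<alpha>\<close> is still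
  unbounded on one of the two pieces. The pieces left behind are disjoint and their values do not
  tend to zero, which contradicts countable additivity.
\<close>

lemma finite_signed_measure_bounded:
  assumes \<alpha>: "finite_signed_measure M \<alpha>"
  obtains c where "\<And>A. A \<in> sets M \<Longrightarrow> \<bar>\<alpha> A\<bar> \<le> c"
proof -
  define unb where "unb E \<longleftrightarrow> E \<in> sets M \<and> (\<forall>c. \<exists>B\<in>sets M. B \<subseteq> E \<and> c < \<bar>\<alpha> B\<bar>)" for E
  have step: "\<exists>E'. unb E' \<and> E' \<subseteq> E \<and> 1 \<le> \<bar>\<alpha> (E - E')\<bar>" if E: "unb E" for E
  proof -
    have Em: "E \<in> sets M" using E by (simp add: unb_def)
    obtain B where B: "B \<in> sets M" "B \<subseteq> E" "1 + \<bar>\<alpha> E\<bar> < \<bar>\<alpha> B\<bar>"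
      using E unfolding unb_def by blast
    have EB: "\<alpha> (E - B) = \<alpha> E - \<alpha> B" by (rule finite_signed_measure_Diff[OF \<alpha> Em B(1,2)])
    show ?thesis
    proof (cases "unb B")
      case True
      have "1 \<le> \<bar>\<alpha> (E - B)\<bar>" using EB B(3) by linarith
      then show ?thesis using True B(2) by (intro exI[of _ B]) simp
    next
      case False
      then obtain c where c: "\<And>C. C \<in> sets M \<Longrightarrow> C \<subseteq> B \<Longrightarrow> \<bar>\<alpha> C\<bar> \<le> c"
        using B(1) unfolding unb_def by (meson not_le)
      have "unb (E - B)"
        unfolding unb_def
      proof (intro conjI allI)
        show "E - B \<in> sets M" using Em B by auto
        fix c'
        obtain C where C: "C \<in> sets M" "C \<subseteq> E" "c + c' < \<bar>\<alpha> C\<bar>"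
          using E unfolding unb_def by blast
        have "\<alpha> C = \<alpha> ((C \<inter> B) \<union> (C - B))" by (simp add: Int_Diff_Un)
        also have "\<dots> = \<alpha> (C \<inter> B) + \<alpha> (C - B)"
          using B C by (intro finite_signed_measure_Un[OF \<alpha>]) auto
        finally have "\<alpha> C = \<alpha> (C \<inter> B) + \<alpha> (C - B)" .
        moreover have "\<bar>\<alpha> (C \<inter> B)\<bar> \<le> c" using B C by (intro c) auto
        ultimately have "c' < \<bar>\<alpha> (C - B)\<bar>" using C(3) by linarith
        then show "\<exists>D\<in>sets M. D \<subseteq> E - B \<and> c' < \<bar>\<alpha> D\<bar>"
          using B C by (intro bexI[of _ "C - B"]) auto
      qed
      moreover have "E - (E - B) = B" using B by auto
      ultimately show ?thesis using B by (intro exI[of _ "E - B"]) auto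
    qed
  qed
  have "\<not> unb (space M)"
  proof
    assume "unb (space M)"
    then have "\<exists>E. \<forall>n::nat. unb (E n) \<and> (E (Suc n) \<subseteq> E n \<and> 1 \<le> \<bar>\<alpha> (E n - E (Suc n))\<bar>)"
      using step by (intro dependent_nat_choice) auto
    then obtain E where E: "\<And>n::nat. unb (E n)" "\<And>n. E (Suc n) \<subseteq> E n"
      "\<And>n. 1 \<le> \<bar>\<alpha> (E n - E (Suc n))\<bar>" by blast
    have mono: "E n \<subseteq> E m" if "m \<le> n" for m n
      using lift_Suc_antimono_le[of E, OF E(2) that] .
    have "disjoint_family (\<lambda>n. E n - E (Suc n))"
      unfolding disjoint_family_on_def
    proof (intro ballI impI)
      fix m n :: nat assume "m \<noteq> n"
      then show "(E m - E (Suc m)) \<inter> (E n - E (Suc n)) = {}"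
        using mono[of "Suc m" n] mono[of "Suc n" m] by (cases "m < n") auto
    qed
    moreover have "range (\<lambda>n. E n - E (Suc n)) \<subseteq> sets M"
      using E(1) by (auto simp: unb_def)
    ultimately have "(\<lambda>n. \<alpha> (E n - E (Suc n))) sums \<alpha> (\<Union>n. E n - E (Suc n))"
      by (rule finite_signed_measureD[OF \<alpha>, rotated])
    then have "(\<lambda>n. \<alpha> (E n - E (Suc n))) \<longlonglongrightarrow> 0"
      by (intro summable_LIMSEQ_zero) (auto simp: sums_iff)
    then have "eventually (\<lambda>n. \<bar>\<alpha> (E n - E (Suc n))\<bar> < 1) sequentially"
      by (auto dest!: tendstoD[where e = 1])
    then show False using E(3) by (auto simp: eventually_sequentially not_less[symmetric])
  qed
  then obtain c where c: "\<not> (\<exists>B\<in>sets M. B \<subseteq> space M \<and> c < \<bar>\<alpha> B\<bar>)"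
    unfolding unb_def by blast
  show thesis
  proof (rule that)
    fix A assume A: "A \<in> sets M"
    then have "\<not> c < \<bar>\<alpha> A\<bar>" using c sets.sets_into_space[OF A] by blast
    then show "\<bar>\<alpha> A\<bar> \<le> c" by simp
  qed
qed

text \<open>The positive part of \<open>\<alpha>\<close> in its Jordan decomposition.\<close>

definition upper_variation :: "'a measure \<Rightarrow> ('a set \<Rightarrow> real) \<Rightarrow> 'a set \<Rightarrow> real" where
  "upper_variation M \<alpha> A = (SUP B\<in>{B\<in>sets M. B \<subseteq> A}. \<alpha> B)"

lemma upper_variation_upper:
  assumes \<alpha>: "finite_signed_measure M \<alpha>" and B: "B \<in> sets M" "B \<subseteq> A"
  shows "\<alpha> B \<le> upper_variation M \<alpha> A"
proof -
  obtain c where "\<And>A. A \<in> sets M \<Longrightarrow> \<bar>\<alpha> A\<bar> \<le> c" by (rule finite_signed_measure_bounded[OF \<alpha>]) blast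
  then have "bdd_above (\<alpha> ` {B\<in>sets M. B \<subseteq> A})"
    by (intro bdd_aboveI2[of _ _ c]) (simp add: abs_le_iff)
  then show ?thesis unfolding upper_variation_def using B by (intro cSUP_upper) simp_all
qed

lemma upper_variation_least:
  assumes "\<And>B. B \<in> sets M \<Longrightarrow> B \<subseteq> A \<Longrightarrow> \<alpha> B \<le> c"
  shows "upper_variation M \<alpha> A \<le> c"
proof -
  have "{} \<in> {B\<in>sets M. B \<subseteq> A}" by simp
  then show ?thesis
    unfolding upper_variation_def by (intro cSUP_least) (use assms in simp_all, blast)
qed

lemma upper_variation_nonneg:
  "finite_signed_measure M \<alpha> \<Longrightarrow> 0 \<le> upper_variation M \<alpha> A"
  using upper_variation_upper[of M \<alpha> "{}" A] by (simp add: finite_signed_measure_empty)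

lemma upper_variation_mono:
  assumes "finite_signed_measure M \<alpha>" "A \<subseteq> B"
  shows "upper_variation M \<alpha> A \<le> upper_variation M \<alpha> B"
proof (rule upper_variation_least)
  fix C assume "C \<in> sets M" "C \<subseteq> A"
  then show "\<alpha> C \<le> upper_variation M \<alpha> B"
    using assms by (intro upper_variation_upper) simp_all
qed

lemma upper_variation_Un_ge:
  assumes \<alpha>: "finite_signed_measure M \<alpha>" and disj: "A \<inter> B = {}"
  shows "upper_variation M \<alpha> A + upper_variation M \<alpha> B \<le> upper_variation M \<alpha> (A \<union> B)"
proof -
  have "upper_variation M \<alpha> A \<le> upper_variation M \<alpha> (A \<union> B) - upper_variation M \<alpha> B"
  proof (rule upper_variation_least)
    fix C assume C: "C \<in> sets M" "C \<subseteq> A"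
    have "upper_variation M \<alpha> B \<le> upper_variation M \<alpha> (A \<union> B) - \<alpha> C"
    proof (rule upper_variation_least)
      fix D assume D: "D \<in> sets M" "D \<subseteq> B"
      have "\<alpha> C + \<alpha> D = \<alpha> (C \<union> D)"
        using C D disj by (intro finite_signed_measure_Un[OF \<alpha>, symmetric]) auto
      also have "\<dots> \<le> upper_variation M \<alpha> (A \<union> B)"
        using C D by (intro upper_variation_upper[OF \<alpha>]) auto
      finally show "\<alpha> D \<le> upper_variation M \<alpha> (A \<union> B) - \<alpha> C" by simp
    qed
    then show "\<alpha> C \<le> upper_variation M \<alpha> (A \<union> B) - upper_variation M \<alpha> B" by simp
  qed
  then show ?thesis by simp
qed

text \<open>
  Boundedness is used tacitly here: it makes all the suprema real numbers, so that superadditivity on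
  finite unions gives one inequality and countable additivity of \<open>\<alpha>\<close> on a subset gives the other.
\<close>

lemma finite_signed_measure_upper_variation:
  assumes \<alpha>: "finite_signed_measure M \<alpha>"
  shows "finite_signed_measure M (upper_variation M \<alpha>)"
  unfolding finite_signed_measure_def
proof (intro conjI allI impI)
  have "upper_variation M \<alpha> {} \<le> 0"
    using finite_signed_measure_empty[OF \<alpha>] by (intro upper_variation_least) simp
  then show "upper_variation M \<alpha> {} = 0" using upper_variation_nonneg[OF \<alpha>, of "{}"] by simp
next
  fix A :: "nat \<Rightarrow> 'a set"
  assume A: "range A \<subseteq> sets M" and disj: "disjoint_family A"
  let ?v = "upper_variation M \<alpha>"
  have partial: "(\<Sum>n<N. ?v (A n)) \<le> ?v (\<Union>n<N. A n)" for N
  proof (induction N)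
    case 0
    show ?case using upper_variation_nonneg[OF \<alpha>, of "{}"] by simp
  next
    case (Suc N)
    have "A n \<inter> A N = {}" if "n < N" for n
      using that by (intro disjoint_family_onD[OF disj]) simp_all
    then have "(\<Union>n<N. A n) \<inter> A N = {}" by auto
    then have "?v (\<Union>n<N. A n) + ?v (A N) \<le> ?v ((\<Union>n<N. A n) \<union> A N)"
      by (rule upper_variation_Un_ge[OF \<alpha>])
    with Suc show ?case by (simp add: lessThan_Suc Un_commute)
  qed
  have le: "(\<Sum>n<N. ?v (A n)) \<le> ?v (\<Union>n. A n)" for N
    using partial[of N] upper_variation_mono[OF \<alpha>, of "\<Union>n<N. A n" "\<Union>n. A n"] by force
  have summ: "summable (\<lambda>n. ?v (A n))"
    by (rule summableI_nonneg_bounded[OF upper_variation_nonneg[OF \<alpha>] le])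
  have "?v (\<Union>n. A n) \<le> (\<Sum>n. ?v (A n))"
  proof (rule upper_variation_least)
    fix B assume B: "B \<in> sets M" "B \<subseteq> (\<Union>n. A n)"
    have "range (\<lambda>n. B \<inter> A n) \<subseteq> sets M" using A B(1) by auto
    moreover have "disjoint_family (\<lambda>n. B \<inter> A n)"
      using disj unfolding disjoint_family_on_def by blast
    ultimately have "(\<lambda>n. \<alpha> (B \<inter> A n)) sums \<alpha> (\<Union>n. B \<inter> A n)"
      by (rule finite_signed_measureD[OF \<alpha>])
    moreover have "(\<Union>n. B \<inter> A n) = B" using B by auto
    ultimately have s: "(\<lambda>n. \<alpha> (B \<inter> A n)) sums \<alpha> B" by simp
    have "(\<Sum>n. \<alpha> (B \<inter> A n)) \<le> (\<Sum>n. ?v (A n))"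
      using s summ A B by (intro suminf_le upper_variation_upper[OF \<alpha>]) (auto simp: sums_iff)
    then show "\<alpha> B \<le> (\<Sum>n. ?v (A n))" using s by (simp add: sums_iff)
  qed
  moreover have "(\<Sum>n. ?v (A n)) \<le> ?v (\<Union>n. A n)"
    by (rule suminf_le_const[OF summ le])
  ultimately show "(\<lambda>n. ?v (A n)) sums ?v (\<Union>n. A n)"
    using summ by (simp add: sums_iff)
qed

text \<open>Subtracting from \<open>\<alpha> A\<close> the value of a subset \<open>B\<close> gives the value of \<open>A - B\<close>; hence the supremum
  of \<open>\<alpha>\<close> over the subsets of \<open>A\<close> exceeds that of \<open>-\<alpha>\<close> by exactly \<open>\<alpha> A\<close>.\<close>

lemma Jordan_decomposition:
  assumes \<alpha>: "finite_signed_measure M \<alpha>" and A: "A \<in> sets M"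
  shows "\<alpha> A = upper_variation M \<alpha> A - upper_variation M (\<lambda>B. - \<alpha> B) A"
proof -
  have n: "finite_signed_measure M (\<lambda>B. - \<alpha> B)" by (rule finite_signed_measure_minus[OF \<alpha>])
  have "upper_variation M \<alpha> A \<le> \<alpha> A + upper_variation M (\<lambda>B. - \<alpha> B) A"
  proof (rule upper_variation_least)
    fix B assume B: "B \<in> sets M" "B \<subseteq> A"
    have "- \<alpha> (A - B) \<le> upper_variation M (\<lambda>B. - \<alpha> B) A"
      using A B by (intro upper_variation_upper[OF n]) auto
    then show "\<alpha> B \<le> \<alpha> A + upper_variation M (\<lambda>B. - \<alpha> B) A"
      using finite_signed_measure_Diff[OF \<alpha> A B] by simp
  qed
  moreover have "upper_variation M (\<lambda>B. - \<alpha> B) A \<le> upper_variation M \<alpha> A - \<alpha> A"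
  proof (rule upper_variation_least)
    fix B assume B: "B \<in> sets M" "B \<subseteq> A"
    have "\<alpha> (A - B) \<le> upper_variation M \<alpha> A"
      using A B by (intro upper_variation_upper[OF \<alpha>]) auto
    then show "- \<alpha> B \<le> upper_variation M \<alpha> A - \<alpha> A"
      using finite_signed_measure_Diff[OF \<alpha> A B] by simp
  qed
  ultimately show ?thesis by simp
qed

section \<open>Densities of vector measures\<close>

lemma nonneg_finite_signed_measure_imp_measure:
  assumes \<alpha>: "finite_signed_measure M \<alpha>" and nn: "\<And>A. A \<in> sets M \<Longrightarrow> 0 \<le> \<alpha> A"
  obtains N where "sets N = sets M" "finite_measure N"
    "\<And>A. A \<in> sets M \<Longrightarrow> emeasure N A = ennreal (\<alpha> A)"
proof -
  define N where "N = measure_of (space M) (sets M) (\<lambda>A. ennreal (\<alpha> A))"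
  have sets: "sets N = sets M" unfolding N_def by (rule sets.sets_measure_of_eq)
  have em: "emeasure N A = ennreal (\<alpha> A)" if A: "A \<in> sets M" for A
    unfolding N_def
  proof (rule emeasure_measure_of_sigma[OF sets.sigma_algebra_axioms _ _ A])
    show "positive (sets M) (\<lambda>A. ennreal (\<alpha> A))"
      by (simp add: positive_def finite_signed_measure_empty[OF \<alpha>])
    show "countably_additive (sets M) (\<lambda>A. ennreal (\<alpha> A))"
      unfolding countably_additive_def
    proof (intro allI impI)
      fix A :: "nat \<Rightarrow> 'a set"
      assume A: "range A \<subseteq> sets M" "disjoint_family A" "(\<Union>i. A i) \<in> sets M"
      then have "(\<lambda>m. \<alpha> (A m)) sums \<alpha> (\<Union>m. A m)"
        by (intro finite_signed_measureD[OF \<alpha>])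
      then show "(\<Sum>i. ennreal (\<alpha> (A i))) = ennreal (\<alpha> (\<Union>i. A i))"
        using A nn by (subst suminf_ennreal2) (auto simp: sums_iff)
    qed
  qed
  have "finite_measure N"
    by (rule finite_measureI) (simp add: em sets_eq_imp_space_eq[OF sets])
  then show thesis using that sets em by blast
qed

lemma dominated_finite_signed_measure_density:
  assumes \<alpha>: "finite_signed_measure M \<alpha>"
    and L: "finite_measure L" "sets L = sets M"
    and nn: "\<And>A. A \<in> sets M \<Longrightarrow> 0 \<le> \<alpha> A"
    and le: "\<And>A. A \<in> sets M \<Longrightarrow> \<alpha> A \<le> measure L A"
  obtains f :: "'a \<Rightarrow> real" where "integrable L f"
    "\<And>A. A \<in> sets M \<Longrightarrow> \<alpha> A = (LINT x:A|L. f x)"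
proof -
  interpret L: finite_measure L by fact
  obtain N where N: "sets N = sets M" "finite_measure N"
    "\<And>A. A \<in> sets M \<Longrightarrow> emeasure N A = ennreal (\<alpha> A)"
    using nonneg_finite_signed_measure_imp_measure[OF \<alpha> nn] by blast
  have ac: "absolutely_continuous L N"
    unfolding absolutely_continuous_def
  proof
    fix A assume "A \<in> null_sets L"
    then have A: "A \<in> sets M" "measure L A = 0" using L by (auto simp: null_sets_def measure_def)
    then show "A \<in> null_sets N"
      using le[OF A(1)] nn[OF A(1)] N(1) N(3)[OF A(1)] by (simp add: null_sets_def)
  qed
  have sNL: "sets N = sets L" using N L by simp
  obtain D where D: "D \<in> borel_measurable L" "AE x in L. RN_deriv L N x = ennreal (D x)"
    "\<And>x. 0 \<le> D x"
    using L.real_RN_deriv[OF N(2) ac sNL] by blast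
  have em: "emeasure N A = (\<integral>\<^sup>+x. ennreal (indicator A x *\<^sub>R D x) \<partial>L)" if A: "A \<in> sets L" for A
  proof -
    have "emeasure N A = emeasure (density L (RN_deriv L N)) A"
      using L.density_RN_deriv[OF ac sNL] by simp
    also have "\<dots> = (\<integral>\<^sup>+x. RN_deriv L N x * indicator A x \<partial>L)"
      using A by (intro emeasure_density) auto
    also have "\<dots> = (\<integral>\<^sup>+x. ennreal (indicator A x *\<^sub>R D x) \<partial>L)"
      using D(2) by (intro nn_integral_cong_AE) (auto split: split_indicator)
    finally show ?thesis .
  qed
  have "(\<integral>\<^sup>+x. ennreal (D x) \<partial>L) = emeasure N (space L)"
    by (subst em) (auto intro!: nn_integral_cong)
  also have "\<dots> < \<infinity>" using N(3)[of "space L"] L by (metis ennreal_less_top infinity_ennreal_def sets.top)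
  finally have int: "integrable L D"
    using D by (intro integrableI_nonneg) auto
  show thesis
  proof (rule that[OF int])
    fix A assume A: "A \<in> sets M"
    then have AL: "A \<in> sets L" using L by simp
    have i: "integrable L (\<lambda>x. indicator A x *\<^sub>R D x)"
      by (rule integrable_mult_indicator[OF AL int])
    have "ennreal (\<alpha> A) = ennreal (LINT x:A|L. D x)"
      using em[OF AL] N(3)[OF A] nn_integral_eq_integral[OF i] D(3)
      by (simp add: set_lebesgue_integral_def)
    moreover have "0 \<le> (LINT x:A|L. D x)"
      unfolding set_lebesgue_integral_def using D(3) by (intro integral_nonneg_AE) auto
    ultimately show "\<alpha> A = (LINT x:A|L. D x)" using nn[OF A] by simp
  qed
qed

text \<open>
  The density is a family of scalar functions rather than one vector-valued function, because the
  density of a product measure is formed separately in each component.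
\<close>

locale vector_density = finite_measure L for L :: "'a measure" +
  fixes M :: "'a measure" and g :: "'n::finite \<Rightarrow> 'a \<Rightarrow> real" and \<mu> :: "'a set \<Rightarrow> real ^ 'n"
  assumes sets_eq: "sets L = sets M"
    and integrable_density: "\<And>i. integrable L (g i)"
    and density: "\<And>A i. A \<in> sets M \<Longrightarrow> \<mu> A $ i = (LINT x:A|L. g i x)"
begin

lemma borel_measurable_density [measurable]: "g i \<in> borel_measurable L"
  using integrable_density by (rule borel_measurable_integrable)

lemma set_integrable_density: "A \<in> sets M \<Longrightarrow> set_integrable L A (g i)"
  unfolding set_integrable_def by (rule integrable_mult_indicator[OF _ integrable_density]) (simp add: sets_eq)

end

text \<open>
  The sum of the positive and negative parts of all components is a finite measure that dominates
  each of these parts; the densities come from the Radon-Nikodym theorem.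
\<close>

lemma finite_signed_vector_measure_has_density:
  fixes \<mu> :: "'a set \<Rightarrow> real ^ 'n"
  assumes \<mu>: "finite_signed_vector_measure M \<mu>"
  obtains L g where "vector_density L M g \<mu>"
proof -
  define p where "p i = upper_variation M (\<lambda>A. \<mu> A $ i)" for i
  define q where "q i = upper_variation M (\<lambda>A. - (\<mu> A $ i))" for i
  have \<mu>i: "finite_signed_measure M (\<lambda>A. \<mu> A $ i)" for i
    using \<mu> by (simp add: finite_signed_vector_measure_def)
  have p: "finite_signed_measure M (p i)" "0 \<le> p i A" for i A
    unfolding p_def using \<mu>i
    by (simp_all add: finite_signed_measure_upper_variation upper_variation_nonneg)
  have q: "finite_signed_measure M (q i)" "0 \<le> q i A" for i A
    unfolding q_def using finite_signed_measure_minus[OF \<mu>i]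
    by (simp_all add: finite_signed_measure_upper_variation upper_variation_nonneg)
  have t: "finite_signed_measure M (\<lambda>A. \<Sum>i\<in>UNIV. p i A + q i A)"
    by (intro finite_signed_measure_sum finite_signed_measure_add p q)
  obtain L where L: "sets L = sets M" "finite_measure L"
    "\<And>A. A \<in> sets M \<Longrightarrow> emeasure L A = ennreal (\<Sum>i\<in>UNIV. p i A + q i A)"
    by (rule nonneg_finite_signed_measure_imp_measure[OF t])
      (auto intro!: sum_nonneg add_nonneg_nonneg p q)
  have mL: "measure L A = (\<Sum>i\<in>UNIV. p i A + q i A)" if "A \<in> sets M" for A
    using L(3)[OF that] p(2) q(2) by (simp add: measure_def sum_nonneg)
  have pq: "p i A + q i A \<le> measure L A" if "A \<in> sets M" for A i
    unfolding mL[OF that] using p(2) q(2)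
    by (intro member_le_sum[of i UNIV "\<lambda>i. p i A + q i A"]) auto
  have "\<exists>f. integrable L f \<and> (\<forall>A\<in>sets M. p i A = (LINT x:A|L. f x))" for i
  proof (rule dominated_finite_signed_measure_density[OF p(1) L(2,1) p(2)])
    show "p i A \<le> measure L A" if "A \<in> sets M" for A
      using pq[OF that, of i] q(2)[of i A] by simp
  qed blast
  then obtain f where f: "\<And>i. integrable L (f i)" "\<And>i A. A \<in> sets M \<Longrightarrow> p i A = (LINT x:A|L. f i x)"
    by metis
  have "\<exists>f. integrable L f \<and> (\<forall>A\<in>sets M. q i A = (LINT x:A|L. f x))" for i
  proof (rule dominated_finite_signed_measure_density[OF q(1) L(2,1) q(2)])
    show "q i A \<le> measure L A" if "A \<in> sets M" for A
      using pq[OF that, of i] p(2)[of i A] by simp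
  qed blast
  then obtain h where h: "\<And>i. integrable L (h i)" "\<And>i A. A \<in> sets M \<Longrightarrow> q i A = (LINT x:A|L. h i x)"
    by metis
  interpret L: finite_measure L by (rule L(2))
  have "vector_density L M (\<lambda>i x. f i x - h i x) \<mu>"
  proof
    fix A i assume A: "A \<in> sets M"
    have si: "set_integrable L A (f i)" "set_integrable L A (h i)"
      unfolding set_integrable_def using A L(1)
      by (simp_all only: integrable_mult_indicator f(1) h(1))
    have "\<mu> A $ i = p i A - q i A"
      unfolding p_def q_def by (rule Jordan_decomposition[OF \<mu>i A])
    then show "\<mu> A $ i = (LINT x:A|L. f i x - h i x)"
      using set_integral_diff(2)[OF si] f(2)[OF A] h(2)[OF A] by simp
  qed (simp_all add: L f h)
  then show thesis by (rule that)
qed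

section \<open>Lorenz hulls are closed\<close>

text \<open>
  A uniform form of extremality. On the compact set of pairs \<open>(u, v)\<close> with \<open>dist u x \<ge> e\<close> the
  distance of the midpoint to \<open>x\<close> attains its minimum, which is positive since \<open>x\<close> is extreme.
\<close>

lemma extreme_point_midpoint_modulus:
  fixes x :: "'a::euclidean_space"
  assumes C: "compact C" and x: "x extreme_point_of C" and e: "0 < e"
  obtains d where "0 < d"
    "\<And>u v. u \<in> C \<Longrightarrow> v \<in> C \<Longrightarrow> dist (midpoint u v) x < d \<Longrightarrow> dist u x < e"
proof -
  define Q where "Q = (C \<times> C) \<inter> {p. e \<le> dist (fst p) x}"
  have "closed {p :: 'a \<times> 'a. e \<le> dist (fst p) x}"
    by (intro closed_Collect_le continuous_intros)
  then have Q: "compact Q" unfolding Q_def by (intro compact_Int_closed compact_Times C)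
  show thesis
  proof (cases "Q = {}")
    case True
    have "dist u x < e" if "u \<in> C" "v \<in> C" for u v
    proof (rule ccontr)
      assume "\<not> dist u x < e"
      then have "(u, v) \<in> Q" using that by (simp add: Q_def)
      then show False using True by simp
    qed
    then show thesis by (intro that[of 1]) simp_all
  next
    case False
    have "continuous_on Q (\<lambda>p. dist (midpoint (fst p) (snd p)) x)"
      unfolding midpoint_def by (intro continuous_intros)
    then obtain p where p: "p \<in> Q"
      "\<And>q. q \<in> Q \<Longrightarrow> dist (midpoint (fst p) (snd p)) x \<le> dist (midpoint (fst q) (snd q)) x"
      using continuous_attains_inf[OF Q False] by blast
    obtain u v where uv: "p = (u, v)" by (cases p)
    have uvC: "u \<in> C" "v \<in> C" "e \<le> dist u x" using p(1) by (simp_all add: Q_def uv)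
    have "midpoint u v \<noteq> x"
    proof
      assume m: "midpoint u v = x"
      have "u \<noteq> v" using m uvC(3) e by auto
      then have "x \<in> open_segment u v" using m midpoint_in_open_segment[of u v] by simp
      then show False using x uvC by (simp add: extreme_point_of_def)
    qed
    then have "0 < dist (midpoint u v) x" by simp
    then show thesis
    proof (rule that)
      fix u' v' assume h: "u' \<in> C" "v' \<in> C" "dist (midpoint u' v') x < dist (midpoint u v) x"
      show "dist u' x < e"
      proof (rule ccontr)
        assume "\<not> dist u' x < e"
        then have "(u', v') \<in> Q" using h by (simp add: Q_def)
        then show False using p(2) h(3) uv by fastforce
      qed
    qed
  qed
qed

context vector_density
begin

lemma measure_Un:
  assumes "A \<in> sets M" "B \<in> sets M" "A \<inter> B = {}"
  shows "\<mu> (A \<union> B) = \<mu> A + \<mu> B"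
  using assms
  by (simp add: vec_eq_iff density set_integral_Un set_integrable_density)

lemma measure_Diff:
  assumes "A \<in> sets M" "B \<in> sets M" "B \<subseteq> A"
  shows "\<mu> (A - B) = \<mu> A - \<mu> B"
proof -
  have "\<mu> (B \<union> (A - B)) = \<mu> B + \<mu> (A - B)"
    using assms by (intro measure_Un) auto
  moreover have "B \<union> (A - B) = A" using assms(3) by blast
  ultimately show ?thesis by simp
qed

text \<open>
  The sum of the total variations of the components, that is, the variation of \<open>\<mu>\<close> for the \<open>l\<^sup>1\<close> norm.
\<close>

definition variation :: "'a measure" where
  "variation = density L (\<lambda>x. ennreal (\<Sum>i\<in>UNIV. \<bar>g i x\<bar>))"

lemma integrable_sum_abs: "integrable L (\<lambda>x. \<Sum>i\<in>UNIV. \<bar>g i x\<bar>)"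
  by (intro Bochner_Integration.integrable_sum integrable_abs integrable_density)

lemma sets_variation [simp]: "sets variation = sets M"
  by (simp add: variation_def sets_eq)

lemma measure_variation:
  assumes A: "A \<in> sets M"
  shows "measure variation A = (\<Sum>i\<in>UNIV. (LINT x:A|L. \<bar>g i x\<bar>))"
proof -
  have AL: "A \<in> sets L" using A by (simp add: sets_eq)
  have i: "integrable L (\<lambda>x. indicator A x *\<^sub>R (\<Sum>i\<in>UNIV. \<bar>g i x\<bar>))"
    by (rule integrable_mult_indicator[OF AL integrable_sum_abs])
  have "emeasure variation A = (\<integral>\<^sup>+x. ennreal (\<Sum>i\<in>UNIV. \<bar>g i x\<bar>) * indicator A x \<partial>L)"
    unfolding variation_def by (rule emeasure_density[OF _ AL]) measurable
  also have "\<dots> = (\<integral>\<^sup>+x. ennreal (indicator A x *\<^sub>R (\<Sum>i\<in>UNIV. \<bar>g i x\<bar>)) \<partial>L)"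
    by (intro nn_integral_cong) (simp split: split_indicator)
  also have "\<dots> = ennreal (LINT x|L. indicator A x *\<^sub>R (\<Sum>i\<in>UNIV. \<bar>g i x\<bar>))"
    by (rule nn_integral_eq_integral[OF i]) (simp add: sum_nonneg)
  finally have "measure variation A = (LINT x|L. indicator A x *\<^sub>R (\<Sum>i\<in>UNIV. \<bar>g i x\<bar>))"
    by (simp add: measure_def sum_nonneg)
  also have "\<dots> = (LINT x|L. (\<Sum>i\<in>UNIV. indicator A x *\<^sub>R \<bar>g i x\<bar>))"
    by (simp add: sum_distrib_left)
  also have "\<dots> = (\<Sum>i\<in>UNIV. (LINT x:A|L. \<bar>g i x\<bar>))"
    unfolding set_lebesgue_integral_def
    by (intro Bochner_Integration.integral_sum integrable_mult_indicator[OF AL]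
        integrable_abs integrable_density)
  finally show ?thesis .
qed

lemma finite_measure_variation: "finite_measure variation"
proof (rule finite_measureI)
  have "emeasure variation (space variation) = (\<integral>\<^sup>+x. ennreal (\<Sum>i\<in>UNIV. \<bar>g i x\<bar>) \<partial>L)"
    unfolding variation_def by (subst emeasure_density) (auto intro!: nn_integral_cong)
  also have "\<dots> = ennreal (LINT x|L. (\<Sum>i\<in>UNIV. \<bar>g i x\<bar>))"
    by (rule nn_integral_eq_integral[OF integrable_sum_abs]) (simp add: sum_nonneg)
  finally show "emeasure variation (space variation) \<noteq> \<infinity>" by simp
qed

lemma norm_le_variation:
  assumes A: "A \<in> sets M"
  shows "norm (\<mu> A) \<le> measure variation A"
proof -
  have "norm (\<mu> A) \<le> (\<Sum>i\<in>UNIV. \<bar>\<mu> A $ i\<bar>)" by (rule norm_le_l1_cart)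
  also have "\<dots> \<le> (\<Sum>i\<in>UNIV. (LINT x:A|L. \<bar>g i x\<bar>))"
  proof (rule sum_mono)
    fix i
    show "\<bar>\<mu> A $ i\<bar> \<le> (LINT x:A|L. \<bar>g i x\<bar>)"
      using set_integral_norm_bound[OF set_integrable_density[OF A, of i]] A by (simp add: density)
  qed
  finally show ?thesis using measure_variation[OF A] by simp
qed

text \<open>
  Conversely, the variation of \<open>A\<close> is controlled by the values of \<open>\<mu>\<close> on its subsets: in
  component \<open>i\<close> it is the difference of the values on the parts of \<open>A\<close> where \<open>g i\<close> is nonnegative
  and negative.
\<close>

lemma variation_le:
  assumes A: "A \<in> sets M"
    and le: "\<And>B. B \<in> sets M \<Longrightarrow> B \<subseteq> A \<Longrightarrow> norm (\<mu> B) \<le> e"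
  shows "measure variation A \<le> 2 * real CARD('n) * e"
proof -
  have i: "(LINT x:A|L. \<bar>g i x\<bar>) \<le> 2 * e" for i
  proof -
    define P where "P = {x\<in>space L. 0 \<le> g i x}"
    have "P \<in> sets L" unfolding P_def by measurable
    then have P: "P \<in> sets M" by (simp add: sets_eq)
    have s: "A \<inter> P \<in> sets M" "A - P \<in> sets M" using A P by simp_all
    have ai: "set_integrable L B (\<lambda>x. \<bar>g i x\<bar>)" if "B \<in> sets M" for B
      using set_integrable_abs[OF set_integrable_density[OF that]] .
    have "(LINT x:A|L. \<bar>g i x\<bar>) = (LINT x:(A \<inter> P) \<union> (A - P)|L. \<bar>g i x\<bar>)"
      by (simp add: Int_Diff_Un)
    also have "\<dots> = (LINT x:A \<inter> P|L. \<bar>g i x\<bar>) + (LINT x:A - P|L. \<bar>g i x\<bar>)"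
      by (rule set_integral_Un) (use ai s in auto)
    also have "(LINT x:A \<inter> P|L. \<bar>g i x\<bar>) = \<mu> (A \<inter> P) $ i"
      unfolding density[OF s(1)]
      by (rule set_lebesgue_integral_cong) (use s sets_eq in \<open>auto simp: P_def\<close>)
    also have "(LINT x:A - P|L. \<bar>g i x\<bar>) = (LINT x:A - P|L. - g i x)"
      by (rule set_lebesgue_integral_cong)
        (use s sets_eq sets.sets_into_space[OF s(2)] sets_eq_imp_space_eq[OF sets_eq] in \<open>auto simp: P_def\<close>)
    also have "\<dots> = - \<mu> (A - P) $ i"
      unfolding density[OF s(2)] set_lebesgue_integral_def by simp
    also have "\<mu> (A \<inter> P) $ i \<le> e"
      using component_le_norm_cart[of "\<mu> (A \<inter> P)" i] le[OF s(1)] by simp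
    also have "- \<mu> (A - P) $ i \<le> e"
      using component_le_norm_cart[of "\<mu> (A - P)" i] le[OF s(2)] by simp
    finally show ?thesis by simp
  qed
  have "measure variation A \<le> (\<Sum>i::'n\<in>UNIV. 2 * e)"
    unfolding measure_variation[OF A] by (intro sum_mono i)
  then show ?thesis by simp
qed

lemma compact_closure_range: "compact (closure (\<mu> ` sets M))"
proof -
  interpret V: finite_measure variation by (rule finite_measure_variation)
  have "norm (\<mu> A) \<le> measure variation (space variation)" if "A \<in> sets M" for A
    using norm_le_variation[OF that] V.bounded_measure[of A] by simp
  then have "bounded (\<mu> ` sets M)" by (auto simp: bounded_iff)
  then show ?thesis by (simp add: compact_closure)
qed

text \<open>
  For \<open>D \<subseteq> A - B\<close> the values of \<open>A - D\<close> and \<open>B \<union> D\<close> have the same midpoint as those of \<open>A\<close> and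
  \<open>B\<close>. When the latter are near the extreme point \<open>x\<close>, so is \<open>\<mu> (A - D)\<close>, and \<open>\<mu> D\<close> is small.
\<close>

lemma extreme_point_variation_modulus:
  assumes x: "x extreme_point_of (convex hull closure (\<mu> ` sets M))" and e: "0 < e"
  obtains d where "0 < d"
    "\<And>A B. A \<in> sets M \<Longrightarrow> B \<in> sets M \<Longrightarrow> dist (\<mu> A) x < d \<Longrightarrow> dist (\<mu> B) x < d \<Longrightarrow>
       measure variation (A - B) < e"
proof -
  \<comment> \<open>Values on subsets of \<open>A - B\<close> will be bounded by \<open>2 \<eta>\<close>, hence its variation by
    \<open>4 CARD('n) \<eta> = e / 2\<close>.\<close>
  define \<eta> where "\<eta> = e / (8 * real CARD('n))"
  have \<eta>: "0 < \<eta>" using e by (simp add: \<eta>_def)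
  let ?C = "convex hull closure (\<mu> ` sets M)"
  have inC: "\<mu> A \<in> ?C" if "A \<in> sets M" for A
    using that closure_subset[of "\<mu> ` sets M"] by (intro hull_inc) blast
  obtain d where d: "0 < d"
    "\<And>u v. u \<in> ?C \<Longrightarrow> v \<in> ?C \<Longrightarrow> dist (midpoint u v) x < d \<Longrightarrow> dist u x < \<eta>"
    using extreme_point_midpoint_modulus[OF compact_convex_hull[OF compact_closure_range] x \<eta>]
    by blast
  show thesis
  proof (rule that[of "min d \<eta>"])
    show "0 < min d \<eta>" using d \<eta> by simp
    fix A B assume A: "A \<in> sets M" and B: "B \<in> sets M"
      and dA: "dist (\<mu> A) x < min d \<eta>" and dB: "dist (\<mu> B) x < min d \<eta>"
    have "measure variation (A - B) \<le> 2 * real CARD('n) * (2 * \<eta>)"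
    proof (rule variation_le)
      show "A - B \<in> sets M" using A B by simp
      fix D assume D: "D \<in> sets M" "D \<subseteq> A - B"
      have uD: "\<mu> (A - D) = \<mu> A - \<mu> D" using A D by (intro measure_Diff) auto
      have vD: "\<mu> (B \<union> D) = \<mu> B + \<mu> D" using B D by (intro measure_Un) auto
      have "midpoint (\<mu> (A - D)) (\<mu> (B \<union> D)) - x =
          (1/2) *\<^sub>R (\<mu> A - x) + (1/2) *\<^sub>R (\<mu> B - x)"
        unfolding uD vD midpoint_def by (simp add: algebra_simps flip: scaleR_add_left)
      then have "norm (midpoint (\<mu> (A - D)) (\<mu> (B \<union> D)) - x) \<le>
          (1/2) * norm (\<mu> A - x) + (1/2) * norm (\<mu> B - x)"
        using norm_triangle_ineq[of "(1/2) *\<^sub>R (\<mu> A - x)" "(1/2) *\<^sub>R (\<mu> B - x)"] by simp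
      also have "\<dots> < d" using dA dB by (simp add: dist_norm)
      finally have "dist (midpoint (\<mu> (A - D)) (\<mu> (B \<union> D))) x < d" by (simp add: dist_norm)
      then have "dist (\<mu> (A - D)) x < \<eta>"
        using A B D by (intro d(2)[of _ "\<mu> (B \<union> D)"] inC) auto
      moreover have "norm (\<mu> D) \<le> dist (\<mu> A) x + dist (\<mu> (A - D)) x"
        unfolding uD using dist_triangle2[of "\<mu> A" "\<mu> A - \<mu> D" x] by (simp add: dist_norm)
      ultimately show "norm (\<mu> D) \<le> 2 * \<eta>" using dA by simp
    qed
    also have "\<dots> < e" using e by (simp add: \<eta>_def)
    finally show "measure variation (A - B) < e" .
  qed
qed

text \<open>
  Completeness of the measure algebra, for a sequence that converges geometrically. The limit is the
  limit inferior \<open>B\<close> of the sets: a point in exactly one of \<open>A m\<close> and \<open>B\<close> must enter or leave the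
  sequence at some step \<open>n \<ge> m\<close>, and the sets \<open>S n\<close> of such points have summable variation.
\<close>

lemma variation_Cauchy_imp_limit:
  assumes A: "\<And>n. A n \<in> sets M"
    and Cauchy: "\<And>k m n. k \<le> m \<Longrightarrow> k \<le> n \<Longrightarrow> measure variation (A m - A n) < (1/2) ^ k"
  obtains B where "B \<in> sets M" "(\<lambda>n. \<mu> (A n)) \<longlonglongrightarrow> \<mu> B"
proof -
  interpret V: finite_measure variation by (rule finite_measure_variation)
  define S where "S n = (A n - A (Suc n)) \<union> (A (Suc n) - A n)" for n
  define B where "B = (\<Union>m. \<Inter>n\<in>{m..}. A n)"
  have S: "S n \<in> sets M" for n unfolding S_def using A by auto
  have B: "B \<in> sets M" unfolding B_def using A by auto
  have Sle: "measure variation (S n) \<le> 2 * (1/2) ^ n" for n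
  proof -
    have "measure variation (S n) \<le>
        measure variation (A n - A (Suc n)) + measure variation (A (Suc n) - A n)"
      unfolding S_def using A by (intro measure_Un_le) simp_all
    then show ?thesis using Cauchy[of n n "Suc n"] Cauchy[of n "Suc n" n] by simp
  qed
  have T: "measure variation (\<Union>k. S (m + k)) \<le> 4 * (1/2) ^ m" for m
  proof -
    have g: "(\<lambda>k. 2 * (1/2) ^ m * (1/2) ^ k :: real) sums (2 * (1/2) ^ m * (1 / (1 - 1/2)))"
      by (intro sums_mult geometric_sums) simp
    have le: "measure variation (S (m + k)) \<le> 2 * (1/2) ^ m * (1/2) ^ k" for k
      using Sle[of "m + k"] by (simp add: power_add)
    have s: "summable (\<lambda>k. measure variation (S (m + k)))"
      by (rule summable_comparison_test'[OF sums_summable[OF g], of 0]) (use le in simp)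
    have "measure variation (\<Union>k. S (m + k)) \<le> (\<Sum>k. measure variation (S (m + k)))"
      using S by (intro V.finite_measure_subadditive_countably s) auto
    also have "\<dots> \<le> (\<Sum>k. 2 * (1/2) ^ m * (1/2) ^ k)"
      by (rule suminf_le[OF le s sums_summable[OF g]])
    also have "\<dots> = 4 * (1/2) ^ m" using sums_unique[OF g] by simp
    finally show ?thesis .
  qed
  have same: "x \<in> A n \<longleftrightarrow> x \<in> A m" if "x \<notin> (\<Union>k. S (m + k))" "m \<le> n" for x m n
    using that(2)
  proof (induction n rule: dec_induct)
    case (step n)
    have "x \<notin> S n" using that(1) step(1) le_Suc_ex by blast
    then show ?case using step(3) by (auto simp: S_def)
  qed simp
  have sub: "B - A m \<subseteq> (\<Union>k. S (m + k))" "A m - B \<subseteq> (\<Union>k. S (m + k))" for m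
  proof -
    show "B - A m \<subseteq> (\<Union>k. S (m + k))"
    proof
      fix x assume x: "x \<in> B - A m"
      show "x \<in> (\<Union>k. S (m + k))"
      proof (rule ccontr)
        assume n: "x \<notin> (\<Union>k. S (m + k))"
        obtain j where j: "\<And>n. j \<le> n \<Longrightarrow> x \<in> A n" using x by (auto simp: B_def)
        show False using j[of "max j m"] same[OF n, of "max j m"] x by simp
      qed
    qed
    show "A m - B \<subseteq> (\<Union>k. S (m + k))"
    proof
      fix x assume x: "x \<in> A m - B"
      show "x \<in> (\<Union>k. S (m + k))"
      proof (rule ccontr)
        assume n: "x \<notin> (\<Union>k. S (m + k))"
        have "x \<in> A j" if "m \<le> j" for j using same[OF n that] x by blast
        then have "x \<in> B" unfolding B_def by blast
        then show False using x by blast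
      qed
    qed
  qed
  have UM: "(\<Union>k. S (m + k)) \<in> sets variation" for m using S by simp
  have bound: "norm (\<mu> (A m) - \<mu> B) \<le> 8 * (1/2) ^ m" for m
  proof -
    have "\<mu> (A m) - \<mu> (A m \<inter> B) = \<mu> (A m - A m \<inter> B)"
      using A B by (intro measure_Diff[symmetric]) auto
    moreover have "\<mu> B - \<mu> (A m \<inter> B) = \<mu> (B - A m \<inter> B)"
      using A B by (intro measure_Diff[symmetric]) auto
    moreover have "A m - A m \<inter> B = A m - B" "B - A m \<inter> B = B - A m" by blast+
    ultimately have "\<mu> (A m) - \<mu> B = \<mu> (A m - B) - \<mu> (B - A m)"
      by (simp add: algebra_simps)
    then have "norm (\<mu> (A m) - \<mu> B) \<le> norm (\<mu> (A m - B)) + norm (\<mu> (B - A m))"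
      by (simp add: norm_triangle_ineq4)
    also have "\<dots> \<le> measure variation (A m - B) + measure variation (B - A m)"
      using A B by (intro add_mono norm_le_variation) auto
    also have "\<dots> \<le> measure variation (\<Union>k. S (m + k)) + measure variation (\<Union>k. S (m + k))"
      by (intro add_mono V.finite_measure_mono sub UM)
    also have "\<dots> \<le> 8 * (1/2) ^ m" using T[of m] by simp
    finally show ?thesis .
  qed
  have "(\<lambda>m. 8 * (1/2) ^ m :: real) \<longlonglongrightarrow> 0"
    by (intro tendsto_mult_right_zero LIMSEQ_realpow_zero) simp_all
  then have "(\<lambda>n. \<mu> (A n) - \<mu> B) \<longlonglongrightarrow> 0"
    by (rule Lim_null_comparison[rotated]) (simp add: bound)
  then have "(\<lambda>n. \<mu> (A n)) \<longlonglongrightarrow> \<mu> B" by (simp add: LIM_zero_iff)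
  with B show thesis by (rule that)
qed

lemma extreme_point_in_range:
  assumes x: "x extreme_point_of (convex hull closure (\<mu> ` sets M))"
  shows "x \<in> \<mu> ` sets M"
proof -
  have "\<forall>k::nat. \<exists>d>0. \<forall>A\<in>sets M. \<forall>B\<in>sets M. dist (\<mu> A) x < d \<longrightarrow> dist (\<mu> B) x < d \<longrightarrow>
       measure variation (A - B) < (1/2) ^ k"
  proof
    fix k :: nat
    have e: "(0::real) < (1/2) ^ k" by simp
    obtain d where "0 < d" "\<And>A B. A \<in> sets M \<Longrightarrow> B \<in> sets M \<Longrightarrow> dist (\<mu> A) x < d \<Longrightarrow>
        dist (\<mu> B) x < d \<Longrightarrow> measure variation (A - B) < (1/2) ^ k"
      by (rule extreme_point_variation_modulus[OF x e]) (rule that)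
    then show "\<exists>d>0. \<forall>A\<in>sets M. \<forall>B\<in>sets M. dist (\<mu> A) x < d \<longrightarrow> dist (\<mu> B) x < d \<longrightarrow>
       measure variation (A - B) < (1/2) ^ k"
      by (intro exI[of _ d]) simp
  qed
  then obtain d where d: "\<And>k::nat. 0 < d k"
    "\<And>k A B. A \<in> sets M \<Longrightarrow> B \<in> sets M \<Longrightarrow> dist (\<mu> A) x < d k \<Longrightarrow> dist (\<mu> B) x < d k \<Longrightarrow>
       measure variation (A - B) < (1/2) ^ k"
    by (auto dest!: choice)
  have cl: "x \<in> closure (\<mu> ` sets M)" using extreme_point_of_convex_hull[OF x] .
  have "\<forall>n. \<exists>A. A \<in> sets M \<and> (\<forall>k\<le>n. dist (\<mu> A) x < d k) \<and> dist (\<mu> A) x < (1/2) ^ n"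
  proof
    fix n
    \<comment> \<open>One value of \<open>\<mu>\<close> must satisfy the closeness conditions of all the levels up to \<open>n\<close> at once,
      so that any two members of the sequence from level \<open>k\<close> on can be compared at level \<open>k\<close>.\<close>
    define r where "r = min (Min (d ` {..n})) ((1/2) ^ n)"
    have "0 < r" using d(1) by (simp add: r_def)
    then obtain y where "y \<in> \<mu> ` sets M" "dist y x < r"
      using closure_approachable[of x "\<mu> ` sets M"] cl by blast
    then obtain A where A: "A \<in> sets M" "dist (\<mu> A) x < r" by blast
    have "r \<le> d k" if "k \<le> n" for k
    proof -
      have "r \<le> Min (d ` {..n})" by (simp add: r_def)
      also have "\<dots> \<le> d k" using that by (intro Min_le) simp_all
      finally show ?thesis .
    qed
    then have "\<forall>k\<le>n. dist (\<mu> A) x < d k" using A(2) less_le_trans by blast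
    moreover have "dist (\<mu> A) x < (1/2) ^ n" using A(2) by (simp add: r_def)
    ultimately show "\<exists>A. A \<in> sets M \<and> (\<forall>k\<le>n. dist (\<mu> A) x < d k) \<and> dist (\<mu> A) x < (1/2) ^ n"
      using A(1) by blast
  qed
  then obtain A where A: "\<And>n. A n \<in> sets M" "\<And>n k. k \<le> n \<Longrightarrow> dist (\<mu> (A n)) x < d k"
    "\<And>n. dist (\<mu> (A n)) x < (1/2) ^ n"
    by (auto dest!: choice)
  have Cauchy: "measure variation (A m - A n) < (1/2) ^ k" if "k \<le> m" "k \<le> n" for k m n
    by (rule d(2)[OF A(1) A(1) A(2)[OF that(1)] A(2)[OF that(2)]])
  obtain B where B: "B \<in> sets M" "(\<lambda>n. \<mu> (A n)) \<longlonglongrightarrow> \<mu> B"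
    by (rule variation_Cauchy_imp_limit[OF A(1) Cauchy])
  have "(\<lambda>n. (1/2) ^ n :: real) \<longlonglongrightarrow> 0" by (intro LIMSEQ_realpow_zero) simp_all
  then have "(\<lambda>n. \<mu> (A n) - x) \<longlonglongrightarrow> 0"
    by (rule Lim_null_comparison[rotated]) (use A(3) in \<open>simp add: dist_norm less_imp_le\<close>)
  then have "(\<lambda>n. \<mu> (A n)) \<longlonglongrightarrow> x" by (simp add: LIM_zero_iff)
  with B(2) have "x = \<mu> B" by (rule LIMSEQ_unique[rotated])
  with B(1) show ?thesis by blast
qed

lemma closed_lorenz_hull: "closed (lorenz_hull M \<mu>)"
proof -
  let ?C = "convex hull closure (\<mu> ` sets M)"
  have c: "compact ?C" by (rule compact_convex_hull[OF compact_closure_range])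
  have "?C = convex hull {x. x extreme_point_of ?C}"
    by (rule Krein_Milman_Minkowski[OF c convex_convex_hull])
  also have "\<dots> \<subseteq> lorenz_hull M \<mu>"
    unfolding lorenz_hull_def using extreme_point_in_range by (intro hull_mono) blast
  finally have "?C \<subseteq> lorenz_hull M \<mu>" .
  moreover have "lorenz_hull M \<mu> \<subseteq> ?C"
    unfolding lorenz_hull_def by (intro hull_mono closure_subset)
  ultimately show ?thesis using compact_imp_closed[OF c] by simp
qed

end

section \<open>Support functions of Lorenz hulls\<close>

text \<open>
  Since \<open>ennreal\<close> sends negative numbers to \<open>0\<close>, this is the integral of the positive part of
  \<open>u \<bullet> g\<close>. Its values are extended nonnegative reals so that Tonelli's theorem applies to it.
\<close>

definition support_integral :: "'a measure \<Rightarrow> ('n::finite \<Rightarrow> 'a \<Rightarrow> real) \<Rightarrow> real ^ 'n \<Rightarrow> ennreal" where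
  "support_integral L g u = (\<integral>\<^sup>+x. ennreal (\<Sum>i\<in>UNIV. u $ i * g i x) \<partial>L)"

context vector_density
begin

lemma integrable_inner_density: "integrable L (\<lambda>x. \<Sum>i\<in>UNIV. u $ i * g i x)"
  by (intro Bochner_Integration.integrable_sum integrable_mult_right integrable_density)

lemma inner_measure:
  assumes A: "A \<in> sets M"
  shows "u \<bullet> \<mu> A = (LINT x:A|L. (\<Sum>i\<in>UNIV. u $ i * g i x))"
proof -
  have AL: "A \<in> sets L" using A by (simp add: sets_eq)
  have "(LINT x:A|L. (\<Sum>i\<in>UNIV. u $ i * g i x)) =
      (LINT x|L. (\<Sum>i\<in>UNIV. u $ i * (indicator A x *\<^sub>R g i x)))"
    unfolding set_lebesgue_integral_def by (simp add: sum_distrib_left mult.left_commute)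
  also have "\<dots> = (\<Sum>i\<in>UNIV. LINT x|L. u $ i * (indicator A x *\<^sub>R g i x))"
    by (intro Bochner_Integration.integral_sum integrable_mult_right
        integrable_mult_indicator[OF AL] integrable_density)
  also have "\<dots> = (\<Sum>i\<in>UNIV. u $ i * (LINT x:A|L. g i x))"
    unfolding set_lebesgue_integral_def by simp
  also have "\<dots> = u \<bullet> \<mu> A" using A by (simp add: inner_vec_def density)
  finally show ?thesis by simp
qed

lemma support_integral_eq_ennreal:
  "support_integral L g u = ennreal (LINT x|L. max 0 (\<Sum>i\<in>UNIV. u $ i * g i x))"
proof -
  have "support_integral L g u = (\<integral>\<^sup>+x. ennreal (max 0 (\<Sum>i\<in>UNIV. u $ i * g i x)) \<partial>L)"
    unfolding support_integral_def by (intro nn_integral_cong) (simp add: max_def ennreal_neg)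
  also have "\<dots> = ennreal (LINT x|L. max 0 (\<Sum>i\<in>UNIV. u $ i * g i x))"
    by (rule nn_integral_eq_integral)
      (simp_all add: integrable_max integrable_inner_density)
  finally show ?thesis .
qed

lemma integral_positive_part_eq_support:
  "(LINT x|L. max 0 (\<Sum>i\<in>UNIV. u $ i * g i x)) = enn2real (support_integral L g u)"
  by (simp add: support_integral_eq_ennreal)

lemma inner_le_support_integral:
  assumes y: "y \<in> lorenz_hull M \<mu>"
  shows "u \<bullet> y \<le> enn2real (support_integral L g u)"
proof -
  let ?s = "enn2real (support_integral L g u)"
  have "\<mu> ` sets M \<subseteq> {y. u \<bullet> y \<le> ?s}"
  proof
    fix z assume "z \<in> \<mu> ` sets M"
    then obtain A where A: "A \<in> sets M" "z = \<mu> A" by blast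
    have AL: "A \<in> sets L" using A(1) by (simp add: sets_eq)
    have "u \<bullet> \<mu> A = (LINT x|L. indicator A x *\<^sub>R (\<Sum>i\<in>UNIV. u $ i * g i x))"
      using inner_measure[OF A(1)] by (simp add: set_lebesgue_integral_def)
    also have "\<dots> \<le> (LINT x|L. max 0 (\<Sum>i\<in>UNIV. u $ i * g i x))"
      by (rule integral_mono)
        (simp_all only: integrable_mult_indicator[OF AL] integrable_inner_density integrable_max
          integrable_zero, simp split: split_indicator)
    finally show "z \<in> {y. u \<bullet> y \<le> ?s}" using A(2) by (simp add: integral_positive_part_eq_support)
  qed
  then have "lorenz_hull M \<mu> \<subseteq> {y. u \<bullet> y \<le> ?s}"
    unfolding lorenz_hull_def by (intro hull_minimal convex_halfspace_le)
  then show ?thesis using y by blast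
qed

text \<open>The maximum over the hull is attained by \<open>\<mu>\<close> on the set where \<open>u \<bullet> g\<close> is nonnegative.\<close>

lemma support_integral_attained:
  obtains y where "y \<in> lorenz_hull M \<mu>" "u \<bullet> y = enn2real (support_integral L g u)"
proof -
  define P where "P = {x\<in>space L. 0 \<le> (\<Sum>i\<in>UNIV. u $ i * g i x)}"
  have "P \<in> sets L" unfolding P_def by measurable
  then have P: "P \<in> sets M" by (simp add: sets_eq)
  have "u \<bullet> \<mu> P = (LINT x|L. indicator P x *\<^sub>R (\<Sum>i\<in>UNIV. u $ i * g i x))"
    using inner_measure[OF P] by (simp add: set_lebesgue_integral_def)
  also have "\<dots> = (LINT x|L. max 0 (\<Sum>i\<in>UNIV. u $ i * g i x))"
    by (rule Bochner_Integration.integral_cong) (auto simp: P_def max_def)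
  finally have "u \<bullet> \<mu> P = enn2real (support_integral L g u)"
    by (simp add: integral_positive_part_eq_support)
  moreover have "\<mu> P \<in> lorenz_hull M \<mu>"
    unfolding lorenz_hull_def using P by (intro hull_inc imageI)
  ultimately show thesis using that by blast
qed

end

text \<open>
  A point outside the closed convex set \<open>LH(\<mu>')\<close> is strictly separated from it by a hyperplane, whose
  normal is a direction in which the point exceeds the support function.
\<close>

lemma lorenz_hull_subset_if_support_integral_le:
  assumes "vector_density L M g \<mu>" "vector_density L' M' g' \<mu>'"
    and le: "\<And>u. support_integral L g u \<le> support_integral L' g' u"
  shows "lorenz_hull M \<mu> \<subseteq> lorenz_hull M' \<mu>'"
proof
  interpret \<mu>: vector_density L M g \<mu> by fact
  interpret \<mu>': vector_density L' M' g' \<mu>' by fact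
  fix z assume z: "z \<in> lorenz_hull M \<mu>"
  show "z \<in> lorenz_hull M' \<mu>'"
  proof (rule ccontr)
    assume "z \<notin> lorenz_hull M' \<mu>'"
    then obtain a b where ab: "a \<bullet> z < b" "\<And>y. y \<in> lorenz_hull M' \<mu>' \<Longrightarrow> b < a \<bullet> y"
      using separating_hyperplane_closed_point[OF _ \<mu>'.closed_lorenz_hull, of z]
      by (auto simp: lorenz_hull_def)
    \<comment> \<open>The hull lies on the upper side of the hyperplane, so the violating direction is \<open>- a\<close>.\<close>
    obtain y where y: "y \<in> lorenz_hull M' \<mu>'" "- a \<bullet> y = enn2real (support_integral L' g' (- a))"
      by (rule \<mu>'.support_integral_attained)
    have "- a \<bullet> z \<le> enn2real (support_integral L g (- a))"
      by (rule \<mu>.inner_le_support_integral[OF z])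
    also have "\<dots> \<le> enn2real (support_integral L' g' (- a))"
      by (rule enn2real_mono[OF le]) (simp add: \<mu>'.support_integral_eq_ennreal)
    also have "\<dots> = - a \<bullet> y" using y(2) by simp
    also have "\<dots> < - b" using ab(2)[OF y(1)] by simp
    finally show False using ab(1) by simp
  qed
qed

lemma support_integral_mono_hull:
  assumes "vector_density L M g \<mu>" "vector_density L' M' g' \<mu>'"
    and sub: "lorenz_hull M \<mu> \<subseteq> lorenz_hull M' \<mu>'"
  shows "support_integral L g u \<le> support_integral L' g' u"
proof -
  interpret \<mu>: vector_density L M g \<mu> by fact
  interpret \<mu>': vector_density L' M' g' \<mu>' by fact
  obtain y where y: "y \<in> lorenz_hull M \<mu>" "u \<bullet> y = enn2real (support_integral L g u)"
    by (rule \<mu>.support_integral_attained)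
  then have "enn2real (support_integral L g u) \<le> enn2real (support_integral L' g' u)"
    using \<mu>'.inner_le_support_integral[of y u] sub by auto
  then have "ennreal (enn2real (support_integral L g u)) \<le> ennreal (enn2real (support_integral L' g' u))"
    by (rule ennreal_leI)
  then show ?thesis by (simp add: \<mu>.support_integral_eq_ennreal \<mu>'.support_integral_eq_ennreal)
qed

lemma lorenz_hull_eq_iff_support_integral_eq:
  assumes "vector_density L M g \<mu>" "vector_density L' M' g' \<mu>'"
  shows "lorenz_hull M \<mu> = lorenz_hull M' \<mu>' \<longleftrightarrow> support_integral L g = support_integral L' g'"
proof
  assume "lorenz_hull M \<mu> = lorenz_hull M' \<mu>'"
  then show "support_integral L g = support_integral L' g'"
    using support_integral_mono_hull[OF assms] support_integral_mono_hull[OF assms(2,1)]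
    by (intro ext order_antisym) auto
next
  assume eq: "support_integral L g = support_integral L' g'"
  show "lorenz_hull M \<mu> = lorenz_hull M' \<mu>'"
    by (rule order_antisym;
        rule lorenz_hull_subset_if_support_integral_le[OF assms] 
             lorenz_hull_subset_if_support_integral_le[OF assms(2,1)]; simp add: eq)
qed

section \<open>Products of signed measures\<close>

lemma finite_signed_measure_set_integral:
  fixes f :: "'a \<Rightarrow> real"
  assumes f: "integrable L f" and sets: "sets L = sets M"
  shows "finite_signed_measure M (\<lambda>A. LINT x:A|L. f x)"
  unfolding finite_signed_measure_def
proof (intro conjI allI impI)
  show "(LINT x:{}|L. f x) = 0" by (simp add: set_lebesgue_integral_def)
next
  fix A :: "nat \<Rightarrow> 'a set"
  assume A: "range A \<subseteq> sets M" and disj: "disjoint_family A"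
  have AL: "A n \<in> sets L" for n using A sets by auto
  have si: "set_integrable L B f" if "B \<in> sets L" for B
    unfolding set_integrable_def by (rule integrable_mult_indicator[OF that f])
  have "(\<lambda>N. LINT x:(\<Union>n<N. A n)|L. f x) \<longlonglongrightarrow> (LINT x:(\<Union>N. \<Union>n<N. A n)|L. f x)"
  proof (rule set_integral_cont_up)
    show "(\<Union>n<N. A n) \<in> sets L" for N using AL by simp
    show "incseq (\<lambda>N. \<Union>n<N. A n)"
      by (rule monoI) (rule UN_mono, simp_all)
    show "set_integrable L (\<Union>N. \<Union>n<N. A n) f"
      using AL by (intro si) simp
  qed
  moreover have "(\<Union>N. \<Union>n<N. A n) = (\<Union>n. A n)" by blast
  moreover have "(LINT x:(\<Union>n<N. A n)|L. f x) = (\<Sum>n<N. LINT x:A n|L. f x)" for N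
  proof (rule set_integral_finite_Union)
    show "disjoint_family_on A {..<N}" by (rule disjoint_family_on_mono[OF _ disj]) simp
  qed (simp_all add: AL si)
  ultimately show "(\<lambda>n. LINT x:A n|L. f x) sums (LINT x:(\<Union>n. A n)|L. f x)"
    by (simp add: sums_def)
qed

lemma finite_signed_measure_cong:
  assumes \<alpha>: "finite_signed_measure M \<alpha>" and eq: "\<And>A. A \<in> sets M \<Longrightarrow> \<beta> A = \<alpha> A"
  shows "finite_signed_measure M \<beta>"
  unfolding finite_signed_measure_def
proof (intro conjI allI impI)
  show "\<beta> {} = 0" using eq[of "{}"] finite_signed_measure_empty[OF \<alpha>] by simp
next
  fix A :: "nat \<Rightarrow> 'a set"
  assume A: "range A \<subseteq> sets M" and disj: "disjoint_family A"
  have "\<beta> (A n) = \<alpha> (A n)" for n using A by (intro eq) auto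
  moreover have "\<beta> (\<Union>n. A n) = \<alpha> (\<Union>n. A n)" using A by (intro eq) auto
  ultimately show "(\<lambda>n. \<beta> (A n)) sums \<beta> (\<Union>n. A n)"
    using finite_signed_measureD[OF \<alpha> A disj] by simp
qed

text \<open>
  Measurable boxes are closed under intersection and generate the product sigma-algebra; the sets on
  which two signed measures agree are closed under complements and countable disjoint unions.
\<close>

lemma finite_signed_measure_eq_on_PiM:
  assumes J: "finite J"
    and \<beta>: "finite_signed_measure (PiM J M) \<beta>" and \<gamma>: "finite_signed_measure (PiM J M) \<gamma>"
    and eq: "\<And>A. (\<And>j. j \<in> J \<Longrightarrow> A j \<in> sets (M j)) \<Longrightarrow> \<beta> (PiE J A) = \<gamma> (PiE J A)"
    and E: "E \<in> sets (PiM J M)"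
  shows "\<beta> E = \<gamma> E"
proof -
  let ?\<Omega> = "\<Pi>\<^sub>E j\<in>J. space (M j)"
  have sig: "sigma_sets ?\<Omega> (prod_algebra J M) = sets (PiM J M)" by (simp add: sets_PiM)
  have top: "?\<Omega> \<in> sets (PiM J M)" using sets.top[of "PiM J M"] by (simp add: space_PiM)
  have "E \<in> sigma_sets ?\<Omega> (prod_algebra J M)" using E sig by simp
  from Int_stable_prod_algebra prod_algebra_sets_into_space this
  show ?thesis
  proof (induction E rule: sigma_sets_induct_disjoint)
    case (basic A)
    then obtain X where "A = PiE J X" "\<And>j. j \<in> J \<Longrightarrow> X j \<in> sets (M j)"
      by (auto simp: prod_algebra_eq_finite[OF J])
    then show ?case using eq by simp
  next
    case empty
    show ?case using finite_signed_measure_empty[OF \<beta>] finite_signed_measure_empty[OF \<gamma>] by simp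
  next
    case (compl A)
    have A: "A \<in> sets (PiM J M)" using compl(1) sig by simp
    have sub: "A \<subseteq> ?\<Omega>" using sets.sets_into_space[OF A] by (simp add: space_PiM)
    have "\<beta> ?\<Omega> = \<gamma> ?\<Omega>" by (rule eq) simp
    then show ?case
      using finite_signed_measure_Diff[OF \<beta> top A sub] finite_signed_measure_Diff[OF \<gamma> top A sub]
        compl(2) by simp
  next
    case (union A)
    have A: "range A \<subseteq> sets (PiM J M)" using union(2) sig by simp
    have "(\<lambda>n. \<beta> (A n)) sums \<beta> (\<Union>n. A n)" by (rule finite_signed_measureD[OF \<beta> A union(1)])
    moreover have "(\<lambda>n. \<beta> (A n)) sums \<gamma> (\<Union>n. A n)"
      using finite_signed_measureD[OF \<gamma> A union(1)] union(3) by simp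
    ultimately show ?case by (rule sums_unique2)
  qed
qed

text \<open>
  By uniqueness, any signed measure with the right values on boxes is the product measure, after
  its values on sets that are not measurable are set to \<open>0\<close>.
\<close>

lemma product_signed_measure_eqI:
  assumes J: "finite J" and \<beta>: "finite_signed_measure (PiM J M) \<beta>"
    and box: "\<And>A. (\<And>j. j \<in> J \<Longrightarrow> A j \<in> sets (M j)) \<Longrightarrow> \<beta> (PiE J A) = (\<Prod>j\<in>J. \<alpha> j (A j))"
    and E: "E \<in> sets (PiM J M)"
  shows "product_signed_measure J M \<alpha> E = \<beta> E"
proof -
  define \<gamma> where "\<gamma> E = (if E \<in> sets (PiM J M) then \<beta> E else 0)" for E
  have \<gamma>: "finite_signed_measure (PiM J M) \<gamma>"
    by (rule finite_signed_measure_cong[OF \<beta>]) (simp add: \<gamma>_def)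
  have \<gamma>box: "\<gamma> (PiE J A) = (\<Prod>j\<in>J. \<alpha> j (A j))" if "\<And>j. j \<in> J \<Longrightarrow> A j \<in> sets (M j)" for A
  proof -
    have "PiE J A \<in> sets (PiM J M)" using J that by (intro sets_PiM_I_finite) simp_all
    then show ?thesis using box[OF that] by (simp add: \<gamma>_def)
  qed
  have "product_signed_measure J M \<alpha> = \<gamma>"
    unfolding product_signed_measure_def
  proof (rule the_equality)
    show "finite_signed_measure (PiM J M) \<gamma> \<and>
        (\<forall>A. (\<forall>j\<in>J. A j \<in> sets (M j)) \<longrightarrow> \<gamma> (PiE J A) = (\<Prod>j\<in>J. \<alpha> j (A j))) \<and>
        (\<forall>E. E \<notin> sets (PiM J M) \<longrightarrow> \<gamma> E = 0)"
      by (intro conjI allI impI \<gamma> \<gamma>box) (simp_all add: \<gamma>_def)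
  next
    fix \<delta>
    assume \<delta>: "finite_signed_measure (PiM J M) \<delta> \<and>
        (\<forall>A. (\<forall>j\<in>J. A j \<in> sets (M j)) \<longrightarrow> \<delta> (PiE J A) = (\<Prod>j\<in>J. \<alpha> j (A j))) \<and>
        (\<forall>E. E \<notin> sets (PiM J M) \<longrightarrow> \<delta> E = 0)"
    show "\<delta> = \<gamma>"
    proof
      fix E
      show "\<delta> E = \<gamma> E"
      proof (cases "E \<in> sets (PiM J M)")
        case True
        have "finite_signed_measure (PiM J M) \<delta>" using \<delta> by blast
        then show ?thesis
        proof (rule finite_signed_measure_eq_on_PiM[OF J _ \<gamma> _ True])
          fix A assume A: "\<And>j. j \<in> J \<Longrightarrow> A j \<in> sets (M j)"
          have "\<delta> (PiE J A) = (\<Prod>j\<in>J. \<alpha> j (A j))" using \<delta> A by blast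
          then show "\<delta> (PiE J A) = \<gamma> (PiE J A)" using \<gamma>box[OF A] by simp
        qed
      next
        case False
        then have "\<delta> E = 0" using \<delta> by blast
        then show ?thesis using False by (simp add: \<gamma>_def)
      qed
    qed
  qed
  then show ?thesis using E by (simp add: \<gamma>_def)
qed

text \<open>
  Here and below the measures are assumed finite for all indices, also outside \<open>J\<close>, because
  the locale \<^locale>\<open>product_sigma_finite\<close> speaks of a family indexed by a whole type.
\<close>

lemma finite_measure_PiM:
  assumes J: "finite J" and L: "\<And>j. finite_measure (L j)"
  shows "finite_measure (PiM J L)"
proof -
  interpret product_sigma_finite L
    unfolding product_sigma_finite_def using L by (simp add: finite_measure_def)
  show ?thesis
  proof (rule finite_measureI)
    have "emeasure (PiM J L) (space (PiM J L)) = (\<Prod>j\<in>J. emeasure (L j) (space (L j)))"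
      unfolding space_PiM by (rule emeasure_PiM[OF J]) simp
    then show "emeasure (PiM J L) (space (PiM J L)) \<noteq> \<infinity>"
      using finite_measure.emeasure_finite[OF L] by (simp add: ennreal_prod_eq_top)
  qed
qed

text \<open>The indicator of a box is the product of the indicators of its sides, so the integral factorises.\<close>

lemma product_density_box:
  fixes f :: "'j \<Rightarrow> 'a \<Rightarrow> real"
  assumes J: "finite J" and L: "\<And>j. finite_measure (L j)"
    and f: "\<And>j. j \<in> J \<Longrightarrow> integrable (L j) (f j)"
    and A: "\<And>j. j \<in> J \<Longrightarrow> A j \<in> sets (L j)"
  shows "(LINT x:PiE J A|PiM J L. (\<Prod>j\<in>J. f j (x j))) = (\<Prod>j\<in>J. LINT x:A j|L j. f j x)"
proof -
  interpret product_sigma_finite L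
    unfolding product_sigma_finite_def using L by (simp add: finite_measure_def)
  have "(LINT x:PiE J A|PiM J L. (\<Prod>j\<in>J. f j (x j))) =
      (LINT x|PiM J L. (\<Prod>j\<in>J. indicator (A j) (x j) *\<^sub>R f j (x j)))"
    unfolding set_lebesgue_integral_def
  proof (rule Bochner_Integration.integral_cong[OF refl])
    fix x assume x: "x \<in> space (PiM J L)"
    have "indicator (PiE J A) x = (\<Prod>j\<in>J. indicator (A j) (x j) :: real)"
    proof (cases "x \<in> PiE J A")
      case True
      then show ?thesis by (simp add: PiE_mem prod.neutral)
    next
      case False
      then obtain j where "j \<in> J" "x j \<notin> A j" using x by (auto simp: space_PiM PiE_iff)
      then have "(\<Prod>j\<in>J. indicator (A j) (x j) :: real) = 0"
        using J by (intro prod_zero bexI[of _ j]) simp_all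
      then show ?thesis using False by simp
    qed
    then show "indicator (PiE J A) x *\<^sub>R (\<Prod>j\<in>J. f j (x j)) =
        (\<Prod>j\<in>J. indicator (A j) (x j) *\<^sub>R f j (x j))"
      by (simp add: prod.distrib)
  qed
  also have "\<dots> = (\<Prod>j\<in>J. LINT x:A j|L j. f j x)"
    unfolding set_lebesgue_integral_def
    by (rule product_integral_prod[OF J]) (rule integrable_mult_indicator[OF A f])
  finally show ?thesis .
qed

lemma vector_density_product:
  fixes \<mu> :: "'j \<Rightarrow> 'a set \<Rightarrow> real ^ 'n"
  assumes J: "finite J" and L: "\<And>j. finite_measure (L j)"
    and \<mu>: "\<And>j. j \<in> J \<Longrightarrow> vector_density (L j) (M j) (g j) (\<mu> j)"
  shows "vector_density (PiM J L) (PiM J M) (\<lambda>i x. \<Prod>j\<in>J. g j i (x j))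
    (product_vector_measure J M \<mu>)"
proof -
  interpret P: finite_measure "PiM J L" by (rule finite_measure_PiM[OF J L])
  interpret product_sigma_finite L
    unfolding product_sigma_finite_def using L by (simp add: finite_measure_def)
  have sL: "sets (L j) = sets (M j)" if "j \<in> J" for j
    by (rule vector_density.sets_eq[OF \<mu>[OF that]])
  have ig: "integrable (L j) (g j i)" if "j \<in> J" for i j
    by (rule vector_density.integrable_density[OF \<mu>[OF that]])
  have sP: "sets (PiM J L) = sets (PiM J M)" by (rule sets_PiM_cong) (simp_all add: sL)
  have iP: "integrable (PiM J L) (\<lambda>x. \<Prod>j\<in>J. g j i (x j))" for i
    by (rule product_integrable_prod[OF J ig])
  show ?thesis
  proof
    fix E i assume E: "E \<in> sets (PiM J M)"
    have "product_signed_measure J M (\<lambda>j A. \<mu> j A $ i) E =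
        (LINT x:E|PiM J L. (\<Prod>j\<in>J. g j i (x j)))"
    proof (rule product_signed_measure_eqI[OF J _ _ E])
      show "finite_signed_measure (PiM J M) (\<lambda>E. LINT x:E|PiM J L. (\<Prod>j\<in>J. g j i (x j)))"
        by (rule finite_signed_measure_set_integral[OF iP sP])
      fix A assume A: "\<And>j. j \<in> J \<Longrightarrow> A j \<in> sets (M j)"
      have "(LINT x:PiE J A|PiM J L. (\<Prod>j\<in>J. g j i (x j))) = (\<Prod>j\<in>J. LINT x:A j|L j. g j i x)"
        by (rule product_density_box[OF J L ig]) (simp_all add: sL A)
      also have "\<dots> = (\<Prod>j\<in>J. \<mu> j (A j) $ i)"
        using vector_density.density[OF \<mu> A] by (intro prod.cong) simp_all
      finally show "(LINT x:PiE J A|PiM J L. (\<Prod>j\<in>J. g j i (x j))) = (\<Prod>j\<in>J. \<mu> j (A j) $ i)" .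
    qed
    then show "product_vector_measure J M \<mu> E $ i = (LINT x:E|PiM J L. (\<Prod>j\<in>J. g j i (x j)))"
      by (simp add: product_vector_measure_def)
  qed (simp_all add: sP iP)
qed

section \<open>Exchanging the factors of a product\<close>

text \<open>
  The support integral of a product, with the coordinate \<open>j\<close> integrated last or first. For a
  fixed \<open>x j\<close>, respectively for fixed other coordinates, the integrand is again that of a support
  integral, in a direction in which the components of \<open>u\<close> are multiplied by the fixed factors.
\<close>

lemma product_support_integral_insert:
  fixes g :: "'j \<Rightarrow> 'n::finite \<Rightarrow> 'a \<Rightarrow> real"
  assumes J: "finite J" "j \<notin> J" and L: "\<And>l. finite_measure (L l)"
    and g [measurable]: "\<And>l i. g l i \<in> borel_measurable (L l)"
  shows "support_integral (PiM (insert j J) L) (\<lambda>i x. \<Prod>l\<in>insert j J. g l i (x l)) u =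
      (\<integral>\<^sup>+y. support_integral (PiM J L) (\<lambda>i x. \<Prod>l\<in>J. g l i (x l)) (\<chi> i. u $ i * g j i y) \<partial>L j)"
    and "support_integral (PiM (insert j J) L) (\<lambda>i x. \<Prod>l\<in>insert j J. g l i (x l)) u =
      (\<integral>\<^sup>+x. support_integral (L j) (g j) (\<chi> i. u $ i * (\<Prod>l\<in>J. g l i (x l))) \<partial>PiM J L)"
proof -
  interpret product_sigma_finite L
    unfolding product_sigma_finite_def using L by (simp add: finite_measure_def)
  have upd: "(\<Prod>l\<in>insert j J. g l i ((x(j := y)) l)) = g j i y * (\<Prod>l\<in>J. g l i (x l))" for i x y
  proof -
    have "(\<Prod>l\<in>J. g l i ((x(j := y)) l)) = (\<Prod>l\<in>J. g l i (x l))"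
      using J(2) by (intro prod.cong) auto
    then show ?thesis using J by simp
  qed
  have meas: "(\<lambda>x. ennreal (\<Sum>i\<in>UNIV. u $ i * (\<Prod>l\<in>insert j J. g l i (x l))))
      \<in> borel_measurable (PiM (insert j J) L)"
    by measurable
  show "support_integral (PiM (insert j J) L) (\<lambda>i x. \<Prod>l\<in>insert j J. g l i (x l)) u =
      (\<integral>\<^sup>+y. support_integral (PiM J L) (\<lambda>i x. \<Prod>l\<in>J. g l i (x l)) (\<chi> i. u $ i * g j i y) \<partial>L j)"
    unfolding support_integral_def product_nn_integral_insert_rev[OF J meas] upd
    by (simp add: mult_ac)
  show "support_integral (PiM (insert j J) L) (\<lambda>i x. \<Prod>l\<in>insert j J. g l i (x l)) u =
      (\<integral>\<^sup>+x. support_integral (L j) (g j) (\<chi> i. u $ i * (\<Prod>l\<in>J. g l i (x l))) \<partial>PiM J L)"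
    unfolding support_integral_def product_nn_integral_insert[OF J meas] upd
    by (simp add: mult_ac)
qed

text \<open>
  In the induction step the induction hypothesis exchanges all the factors but \<open>j\<close> inside
  the integral over coordinate \<open>j\<close>; after a change of the order of integration factor \<open>j\<close> is innermost
  and can be exchanged as well. The two families may live on different types of spaces, since no
  mixed product is formed except the binary one of \<open>PiM J K\<close> with \<open>L j\<close>.
\<close>

lemma product_support_integral_cong:
  fixes g :: "'j \<Rightarrow> 'n::finite \<Rightarrow> 'a \<Rightarrow> real" and h :: "'j \<Rightarrow> 'n \<Rightarrow> 'b \<Rightarrow> real"
  assumes J: "finite J"
    and L: "\<And>j. finite_measure (L j)" and K: "\<And>j. finite_measure (K j)"
    and g [measurable]: "\<And>j i. g j i \<in> borel_measurable (L j)"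
    and h [measurable]: "\<And>j i. h j i \<in> borel_measurable (K j)"
    and eq: "\<And>j. j \<in> J \<Longrightarrow> support_integral (L j) (g j) = support_integral (K j) (h j)"
  shows "support_integral (PiM J L) (\<lambda>i x. \<Prod>j\<in>J. g j i (x j)) =
      support_integral (PiM J K) (\<lambda>i x. \<Prod>j\<in>J. h j i (x j))"
  using J eq
proof (induction J rule: finite_induct)
  case empty
  show ?case
    by (rule ext) (simp add: support_integral_def PiM_empty nn_integral_count_space_finite)
next
  case (insert j J)
  let ?G = "\<lambda>i x. \<Prod>l\<in>J. g l i (x l)" and ?H = "\<lambda>i x. \<Prod>l\<in>J. h l i (x l)"
  interpret L: finite_measure "L j" by (rule L)
  interpret P: finite_measure "PiM J K" by (rule finite_measure_PiM[OF insert(1) K])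
  interpret pair_sigma_finite "PiM J K" "L j" ..
  have IH: "support_integral (PiM J L) ?G = support_integral (PiM J K) ?H"
    using insert by simp
  show ?case
  proof
    fix u :: "real ^ 'n"
    have "support_integral (PiM (insert j J) L) (\<lambda>i x. \<Prod>l\<in>insert j J. g l i (x l)) u =
        (\<integral>\<^sup>+y. support_integral (PiM J K) ?H (\<chi> i. u $ i * g j i y) \<partial>L j)"
      unfolding product_support_integral_insert(1)[OF insert(1,2) L g] IH ..
    also have "\<dots> = (\<integral>\<^sup>+y. \<integral>\<^sup>+x. ennreal (\<Sum>i\<in>UNIV. u $ i * g j i y * ?H i x) \<partial>PiM J K \<partial>L j)"
      by (simp add: support_integral_def)
    also have "\<dots> = (\<integral>\<^sup>+x. \<integral>\<^sup>+y. ennreal (\<Sum>i\<in>UNIV. u $ i * g j i y * ?H i x) \<partial>L j \<partial>PiM J K)"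
      by (rule Fubini') measurable
    also have "\<dots> = (\<integral>\<^sup>+x. support_integral (L j) (g j) (\<chi> i. u $ i * ?H i x) \<partial>PiM J K)"
      by (simp add: support_integral_def mult_ac)
    also have "\<dots> = (\<integral>\<^sup>+x. support_integral (K j) (h j) (\<chi> i. u $ i * ?H i x) \<partial>PiM J K)"
      by (simp add: insert(4))
    also have "\<dots> = support_integral (PiM (insert j J) K) (\<lambda>i x. \<Prod>l\<in>insert j J. h l i (x l)) u"
      unfolding product_support_integral_insert(2)[OF insert(1,2) K h] ..
    finally show "support_integral (PiM (insert j J) L) (\<lambda>i x. \<Prod>l\<in>insert j J. g l i (x l)) u =
        support_integral (PiM (insert j J) K) (\<lambda>i x. \<Prod>l\<in>insert j J. h l i (x l)) u" .
  qed
qed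

text \<open>Outside \<open>J\<close> the null measure with density \<open>0\<close> completes the family.\<close>

lemma vector_density_family:
  fixes \<mu> :: "'j \<Rightarrow> 'a set \<Rightarrow> real ^ 'n"
  assumes "\<And>j. j \<in> J \<Longrightarrow> finite_signed_vector_measure (M j) (\<mu> j)"
  obtains L g where "\<And>j. finite_measure (L j)" "\<And>j i. g j i \<in> borel_measurable (L j)"
    "\<And>j. j \<in> J \<Longrightarrow> vector_density (L j) (M j) (g j) (\<mu> j)"
proof -
  have "\<exists>p. finite_measure (fst p) \<and> (\<forall>i. snd p i \<in> borel_measurable (fst p)) \<and>
      (j \<in> J \<longrightarrow> vector_density (fst p) (M j) (snd p) (\<mu> j))" for j
  proof (cases "j \<in> J")
    case True
    obtain L g where "vector_density L (M j) g (\<mu> j)"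
      by (rule finite_signed_vector_measure_has_density[OF assms[OF True]])
    then interpret vector_density L "M j" g "\<mu> j" .
    show ?thesis
      by (intro exI[of _ "(L, g)"])
        (simp add: finite_measure_axioms vector_density_axioms)
  next
    case False
    have "finite_measure (null_measure (M j))" by (rule finite_measureI) simp
    then show ?thesis using False by (intro exI[of _ "(null_measure (M j), \<lambda>i x. 0)"]) simp
  qed
  then obtain p where "\<And>j. finite_measure (fst (p j)) \<and>
      (\<forall>i. snd (p j) i \<in> borel_measurable (fst (p j))) \<and>
      (j \<in> J \<longrightarrow> vector_density (fst (p j)) (M j) (snd (p j)) (\<mu> j))"
    by metis
  then show thesis by (intro that[of "\<lambda>j. fst (p j)" "\<lambda>j. snd (p j)"]) blast+
qed

theorem theorem1:
  fixes k :: nat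
    and H :: "nat \<Rightarrow> (real ^ 'n) set"
    and S :: "nat \<Rightarrow> 'a measure" and \<mu> :: "nat \<Rightarrow> 'a set \<Rightarrow> real ^ 'n"
    and T :: "nat \<Rightarrow> 'b measure" and \<nu> :: "nat \<Rightarrow> 'b set \<Rightarrow> real ^ 'n"
  assumes "k \<ge> 1"
    and "\<And>j. j \<in> {1..k} \<Longrightarrow> finite_signed_vector_measure (S j) (\<mu> j)"
    and "\<And>j. j \<in> {1..k} \<Longrightarrow> lorenz_hull (S j) (\<mu> j) = H j"
    and "\<And>j. j \<in> {1..k} \<Longrightarrow> finite_signed_vector_measure (T j) (\<nu> j)"
    and "\<And>j. j \<in> {1..k} \<Longrightarrow> lorenz_hull (T j) (\<nu> j) = H j"
  shows "lorenz_hull (PiM {1..k} T) (product_vector_measure {1..k} T \<nu>)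
       = lorenz_hull (PiM {1..k} S) (product_vector_measure {1..k} S \<mu>)"
proof -
  obtain L g where L: "\<And>j. finite_measure (L j)" "\<And>j i. g j i \<in> borel_measurable (L j)"
    "\<And>j. j \<in> {1..k} \<Longrightarrow> vector_density (L j) (S j) (g j) (\<mu> j)"
    using vector_density_family[of "{1..k}" S \<mu>] assms(2) by blast
  obtain K h where K: "\<And>j. finite_measure (K j)" "\<And>j i. h j i \<in> borel_measurable (K j)"
    "\<And>j. j \<in> {1..k} \<Longrightarrow> vector_density (K j) (T j) (h j) (\<nu> j)"
    using vector_density_family[of "{1..k}" T \<nu>] assms(4) by blast
  have "support_integral (K j) (h j) = support_integral (L j) (g j)" if "j \<in> {1..k}" for j
    using lorenz_hull_eq_iff_support_integral_eq[OF K(3) L(3), OF that that]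
      assms(3)[OF that] assms(5)[OF that] by simp
  then have "support_integral (PiM {1..k} K) (\<lambda>i x. \<Prod>j\<in>{1..k}. h j i (x j)) =
      support_integral (PiM {1..k} L) (\<lambda>i x. \<Prod>j\<in>{1..k}. g j i (x j))"
    by (intro product_support_integral_cong K L) simp_all
  moreover have "vector_density (PiM {1..k} K) (PiM {1..k} T)
      (\<lambda>i x. \<Prod>j\<in>{1..k}. h j i (x j)) (product_vector_measure {1..k} T \<nu>)"
    by (rule vector_density_product[OF finite_atLeastAtMost K(1) K(3)])
  moreover have "vector_density (PiM {1..k} L) (PiM {1..k} S)
      (\<lambda>i x. \<Prod>j\<in>{1..k}. g j i (x j)) (product_vector_measure {1..k} S \<mu>)"
    by (rule vector_density_product[OF finite_atLeastAtMost L(1) L(3)])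
  ultimately show ?thesis
    using lorenz_hull_eq_iff_support_integral_eq by blast
qed

end
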